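(* Let $\mathbf S=(S,\wedge,0)$ be a meet-semilattice with least element $0$ satisfying the Ascending Chain Condition and let $a,b\in S$. Then the following hold: (i) $a^0$ is an antichain; (ii) $a\leq_1 a^{00}$; (iii) $a\leq b$ implies $b^0\leq_1 a^0$; (iv) $0^0=\operatorname{Max} S$; (v) $a\wedge a^0=0$; (vi) if $\mathbf S$ is bounded (i.e. it also has a greatest element $1$) then $0^0=1$ and $1^0=0$; (vii) $a\wedge 0^0\approx_1 a$; (viii) $a\wedge(a\wedge b)^0\approx_1 a\wedge b^0$.
   Context: The Ascending Chain Condition (ACC) means there is no infinite strictly ascending chain; hence every element of any subset $A$ lies below a maximal element of $A$. Singletons are identified with their unique element (one writes $x$ for $\{x\}$). For a subset $A$ of a poset, $\operatorname{Max} A$ denotes the set of all maximal elements of $A$. For subsets $A,B$ of $S$: $A\leq_1 B$ means that for every $a\in A$ there exists some $b\in B$ with $a\leq b$; $A\approx_1 B$ means $A\leq_1 B$ and $B\leq_1 A$; and $A\wedge B:=\{a\wedge b\mid a\in A,\ b\in B\}$. When an element of $S$ occurs in one of these notations it stands for the corresponding singleton. For $a\in S$ define the (unsharp negation) subset $a^0:=\operatorname{Max}\{x\in S\mid a\wedge x=0\}$ of $S$, and for $A\subseteq S$ define $A^0:=\operatorname{Max}\{x\in S\mid A\wedge x=0\}$ (where $A\wedge x=0$ means $A\wedge\{x\}=\{0\}$). Further, $a^{00}:=(a^0)^0$. *)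

theory Defs
  imports Main
begin

text \<open>Meet-semilattices with least element are the types of sort
  \<open>{semilattice_inf, order_bot}\<close>: the carrier is the whole type, \<open>inf\<close> is the meet and
  \<open>bot\<close> is 0. Elements that the informal notation identifies with singletons are written
  as explicit singletons.\<close>

definition ascending_chain_condition :: "'a::order itself \<Rightarrow> bool" where
  "ascending_chain_condition _ \<longleftrightarrow> \<not> (\<exists>c :: nat \<Rightarrow> 'a. strict_mono c)"

definition maximals :: "'a::order set \<Rightarrow> 'a set" where
  "maximals A = {m \<in> A. \<not> (\<exists>x\<in>A. m < x)}"

definition antichain :: "'a::order set \<Rightarrow> bool" where
  "antichain A \<longleftrightarrow> (\<forall>x\<in>A. \<forall>y\<in>A. x \<noteq> y \<longrightarrow> \<not> x \<le> y \<and> \<not> y \<le> x)"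

definition le1 :: "'a::order set \<Rightarrow> 'a set \<Rightarrow> bool" (infix \<open>\<le>\<^sub>1\<close> 50) where
  "A \<le>\<^sub>1 B \<longleftrightarrow> (\<forall>a\<in>A. \<exists>b\<in>B. a \<le> b)"

definition equiv1 :: "'a::order set \<Rightarrow> 'a set \<Rightarrow> bool" (infix \<open>\<approx>\<^sub>1\<close> 50) where
  "A \<approx>\<^sub>1 B \<longleftrightarrow> A \<le>\<^sub>1 B \<and> B \<le>\<^sub>1 A"

definition set_meet :: "'a::semilattice_inf set \<Rightarrow> 'a set \<Rightarrow> 'a set" (infixl \<open>\<and>\<^sub>S\<close> 70) where
  "A \<and>\<^sub>S B = {inf a b | a b. a \<in> A \<and> b \<in> B}"

definition neg :: "'a::{semilattice_inf,order_bot} \<Rightarrow> 'a set" where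
  "neg a = maximals {x. inf a x = bot}"

text \<open>For empty \<open>A\<close> no \<open>x\<close> satisfies the equation below (its left side is empty), so
  \<open>neg_set {} = {}\<close>; sets of the form \<open>neg a\<close> are nonempty under the ascending chain
  condition.\<close>
definition neg_set :: "'a::{semilattice_inf,order_bot} set \<Rightarrow> 'a set" where
  "neg_set A = maximals {x. A \<and>\<^sub>S {x} = {bot}}"

end

theory Submission
  imports Defs
begin

text \<open>The ascending chain condition says that \<open>>\<close> is well-founded, so every element of a set
  lies below a maximal element of that set (\<open>below_maximal\<close>). For negations this
  becomes \<open>le_neg_if_disjoint\<close>: every \<open>x\<close> disjoint from \<open>a\<close> lies below some element
  of \<open>neg a\<close>, while by definition each element of \<open>neg a\<close> is disjoint from \<open>a\<close>. Hence, to bound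
  an element by a member of \<open>neg a\<close>, it suffices to compute one meet.

  This settles every comparison. For \<open>{a} \<le>\<^sub>1 neg_set (neg a)\<close>, disjointness is symmetric, so
  \<open>a\<close> competes in the maximum defining \<open>neg_set (neg a)\<close>. If \<open>a \<le> b\<close>, whatever is disjoint
  from \<open>b\<close> is disjoint from \<open>a\<close>. The last equivalence rests on
  \<open>inf (inf a b) x = inf b (inf a x)\<close>: if \<open>x\<close> is disjoint from \<open>inf a b\<close>, then \<open>inf a x\<close>
  is disjoint from \<open>b\<close>, so \<open>inf a x\<close> lies below some \<open>y\<close> in \<open>neg b\<close>
  and hence below \<open>inf a y\<close>.\<close>

lemma below_maximal:
  fixes x :: "'a::order"
  assumes acc: "ascending_chain_condition TYPE('a)" and x: "x \<in> A"
  obtains m where "m \<in> maximals A" "x \<le> m"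
proof -
  have wf: "wf {(v, u :: 'a). u < v}"
    using acc by (auto simp: wf_iff_no_infinite_down_chain ascending_chain_condition_def
        strict_mono_Suc_iff)
  obtain m where m: "m \<in> {y \<in> A. x \<le> y}"
    and top: "\<And>y. m < y \<Longrightarrow> y \<notin> {y \<in> A. x \<le> y}"
    using wfE_min[OF wf, of x "{y \<in> A. x \<le> y}"] x by auto
  have "m \<in> maximals A"
    using m top by (auto simp: maximals_def dest: order.strict_implies_order order_trans)
  then show thesis using m that by blast
qed

lemma antichain_maximals: "antichain (maximals A)"
  by (auto simp: antichain_def maximals_def less_le)

lemma inf_neg: "x \<in> neg a \<Longrightarrow> inf a x = bot"
  by (simp add: neg_def maximals_def)

lemma le_neg_if_disjoint:
  fixes a x :: "'a::{semilattice_inf,order_bot}"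
  assumes "ascending_chain_condition TYPE('a)" and "inf a x = bot"
  obtains y where "y \<in> neg a" "x \<le> y"
  using below_maximal[OF assms(1), of x "{x. inf a x = bot}"] assms(2)
  unfolding neg_def by blast

text \<open>Since \<open>bot\<close> is disjoint from everything, it lies below some member of \<open>neg a\<close>. This is what
  keeps meets with \<open>neg a\<close> from degenerating to the empty set.\<close>

lemma neg_nonempty:
  fixes a :: "'a::{semilattice_inf,order_bot}"
  assumes "ascending_chain_condition TYPE('a)"
  shows "neg a \<noteq> {}"
  using le_neg_if_disjoint[OF assms, of a bot] by (metis empty_iff inf_absorb2 bot_least)

lemma set_meet_neg:
  fixes a :: "'a::{semilattice_inf,order_bot}"
  assumes "ascending_chain_condition TYPE('a)"
  shows "{a} \<and>\<^sub>S neg a = {bot}"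
  using neg_nonempty[OF assms, of a] by (force simp: set_meet_def inf_neg)

lemma le1_neg_neg:
  fixes a :: "'a::{semilattice_inf,order_bot}"
  assumes "ascending_chain_condition TYPE('a)"
  shows "{a} \<le>\<^sub>1 neg_set (neg a)"
proof -
  have "neg a \<and>\<^sub>S {a} = {a} \<and>\<^sub>S neg a"
    by (auto simp: set_meet_def inf_commute)
  then have "a \<in> {x. neg a \<and>\<^sub>S {x} = {bot}}"
    using set_meet_neg[OF assms] by simp
  from below_maximal[OF assms this] show ?thesis
    unfolding le1_def neg_set_def by blast
qed

lemma neg_antimono:
  fixes a b :: "'a::{semilattice_inf,order_bot}"
  assumes acc: "ascending_chain_condition TYPE('a)" and "a \<le> b"
  shows "neg b \<le>\<^sub>1 neg a"
  unfolding le1_def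
proof
  fix x assume "x \<in> neg b"
  then have "inf a x \<le> bot"
    using inf_mono[OF \<open>a \<le> b\<close> order_refl[of x]] by (simp add: inf_neg)
  then have "inf a x = bot" by (rule bot.extremum_uniqueI)
  then show "\<exists>y\<in>neg a. x \<le> y"
    using le_neg_if_disjoint[OF acc] by blast
qed

lemma neg_bot: "neg bot = maximals UNIV"
  by (simp add: neg_def inf_absorb1)

lemma neg_bot_eq_top:
  fixes t :: "'a::{semilattice_inf,order_bot}"
  assumes "\<And>x. x \<le> t"
  shows "neg bot = {t}"
  using assms by (auto simp: neg_bot maximals_def less_le_not_le intro: order_antisym)

lemma neg_top:
  fixes t :: "'a::{semilattice_inf,order_bot}"
  assumes "\<And>x. x \<le> t"
  shows "neg t = {bot}"
  using assms by (auto simp: neg_def maximals_def inf_absorb2)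

lemma set_meet_neg_bot:
  fixes a :: "'a::{semilattice_inf,order_bot}"
  assumes acc: "ascending_chain_condition TYPE('a)"
  shows "{a} \<and>\<^sub>S neg bot \<approx>\<^sub>1 {a}"
proof -
  obtain m where m: "m \<in> neg bot" "a \<le> m"
    using le_neg_if_disjoint[OF acc, of bot a] by (metis inf_absorb1 bot_least)
  then have "inf a m \<in> {a} \<and>\<^sub>S neg bot"
    by (auto simp: set_meet_def)
  with m have "{a} \<le>\<^sub>1 {a} \<and>\<^sub>S neg bot"
    by (auto simp: le1_def inf_absorb1)
  then show ?thesis
    by (auto simp: equiv1_def le1_def set_meet_def)
qed

lemma set_meet_le1:
  assumes "\<And>x. x \<in> X \<Longrightarrow> \<exists>y\<in>Y. inf a x \<le> y"
  shows "{a} \<and>\<^sub>S X \<le>\<^sub>1 {a} \<and>\<^sub>S Y"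
  unfolding le1_def
proof
  fix z assume "z \<in> {a} \<and>\<^sub>S X"
  then obtain x where "x \<in> X" and z: "z = inf a x"
    by (auto simp: set_meet_def)
  then obtain y where "y \<in> Y" "z \<le> inf a y"
    using assms by auto
  then show "\<exists>w\<in>{a} \<and>\<^sub>S Y. z \<le> w"
    by (auto simp: set_meet_def)
qed

lemma set_meet_neg_inf:
  fixes a b :: "'a::{semilattice_inf,order_bot}"
  assumes acc: "ascending_chain_condition TYPE('a)"
  shows "{a} \<and>\<^sub>S neg (inf a b) \<approx>\<^sub>1 {a} \<and>\<^sub>S neg b"
  unfolding equiv1_def
proof
  show "{a} \<and>\<^sub>S neg (inf a b) \<le>\<^sub>1 {a} \<and>\<^sub>S neg b"
  proof (rule set_meet_le1)
    fix x assume "x \<in> neg (inf a b)"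
    then have "inf b (inf a x) = bot"
      using inf_neg by (metis inf_assoc inf_commute)
    then show "\<exists>y\<in>neg b. inf a x \<le> y"
      using le_neg_if_disjoint[OF acc] by blast
  qed
  have "neg b \<le>\<^sub>1 neg (inf a b)"
    by (rule neg_antimono[OF acc]) simp
  then show "{a} \<and>\<^sub>S neg b \<le>\<^sub>1 {a} \<and>\<^sub>S neg (inf a b)"
    by (intro set_meet_le1) (auto simp: le1_def intro: le_infI2)
qed

theorem theorem3p1:
  fixes a b :: "'a::{semilattice_inf,order_bot}"
  assumes "ascending_chain_condition TYPE('a)"
  shows "antichain (neg a) \<and>
    {a} \<le>\<^sub>1 neg_set (neg a) \<and>
    (a \<le> b \<longrightarrow> neg b \<le>\<^sub>1 neg a) \<and>
    neg (bot :: 'a) = maximals UNIV \<and>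
    {a} \<and>\<^sub>S neg a = {bot} \<and>
    (\<forall>t :: 'a. (\<forall>x. x \<le> t) \<longrightarrow> neg (bot :: 'a) = {t} \<and> neg t = {bot}) \<and>
    {a} \<and>\<^sub>S neg bot \<approx>\<^sub>1 {a} \<and>
    {a} \<and>\<^sub>S neg (inf a b) \<approx>\<^sub>1 {a} \<and>\<^sub>S neg b"
proof (intro conjI allI impI)
  show "antichain (neg a)"
    unfolding neg_def by (rule antichain_maximals)
qed (simp_all add: assms le1_neg_neg neg_antimono neg_bot set_meet_neg
    neg_bot_eq_top[unfolded neg_bot] neg_top set_meet_neg_bot[unfolded neg_bot]
    set_meet_neg_inf)

end
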